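(* Let $(X,*,0)$ be a bounded commutative BCK-algebra with greatest element $1$ and let $\mu:X\to X$ be a state-morphism operator such that $\mu(1)=1$. Then $(X,\mu)$ is a state-morphism MV-algebra, where $X$ carries its associated MV-algebra structure $(X,\oplus,',0)$.
   Context: A BCK-algebra is an algebra $(X,*,0)$ of type $(2,0)$ such that for all $x,y,z\in X$: $((x*y)*(x*z))*(z*y)=0$; $x*0=x$; $x*y=0$ and $y*x=0$ imply $x=y$; $0*x=0$. It is partially ordered by $x\le y\iff x*y=0$. It is bounded if it has a greatest element $1$ (and then $Nx:=1*x$), and commutative if $x*(x*y)=y*(y*x)$ for all $x,y$. A state-morphism operator on a BCK-algebra $X$ is a map $\mu:X\to X$ with $\mu(x*y)=\mu(x)*\mu(y)$ for all $x,y$ and $\mu\circ\mu=\mu$. An MV-algebra is an algebra $(M,\oplus,',0)$ of type $(2,1,0)$ where $(M,\oplus,0)$ is a commutative monoid with neutral element $0$, $x''=x$, $x\oplus 1=1$ with $1=0'$, and $x\oplus(x\oplus y')'=y\oplus(y\oplus x')'$. If $X$ is a bounded commutative BCK-algebra, the associated MV-algebra $(X,\oplus,',0)$ is given by $x\oplus y=N(Nx*y)$ and $x'=Nx$. A state-morphism MV-algebra is a pair $(M,\sigma)$ where $M$ is an MV-algebra and $\sigma:M\to M$ is an MV-homomorphism with $\sigma\circ\sigma=\sigma$. *)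

theory Defs
  imports "HOL-Algebra.Group"
begin

text \<open>Algebras are given by an explicit carrier set; the values of the operations outside
  the carrier are irrelevant.\<close>

locale bck_algebra =
  fixes X :: "'a set"
    and star :: "'a \<Rightarrow> 'a \<Rightarrow> 'a"  (infixl \<open>\<star>\<close> 70)
    and zero :: 'a  (\<open>\<zero>\<close>)
  assumes star_closed: "x \<in> X \<Longrightarrow> y \<in> X \<Longrightarrow> x \<star> y \<in> X"
    and zero_closed: "\<zero> \<in> X"
    and bck1: "x \<in> X \<Longrightarrow> y \<in> X \<Longrightarrow> z \<in> X \<Longrightarrow> ((x \<star> y) \<star> (x \<star> z)) \<star> (z \<star> y) = \<zero>"
    and bck2: "x \<in> X \<Longrightarrow> x \<star> \<zero> = x"
    and bck3: "x \<in> X \<Longrightarrow> y \<in> X \<Longrightarrow> x \<star> y = \<zero> \<Longrightarrow> y \<star> x = \<zero> \<Longrightarrow> x = y"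
    and bck4: "x \<in> X \<Longrightarrow> \<zero> \<star> x = \<zero>"

definition bck_le :: "('a \<Rightarrow> 'a \<Rightarrow> 'a) \<Rightarrow> 'a \<Rightarrow> 'a \<Rightarrow> 'a \<Rightarrow> bool" where
  "bck_le star zero x y \<longleftrightarrow> star x y = zero"

text \<open>The greatest element 1 is called \<open>u\<close>, as \<open>one\<close> is a field of the monoid record.\<close>

locale bounded_bck_algebra = bck_algebra +
  fixes u :: 'a
  assumes u_closed: "u \<in> X"
    and u_greatest: "x \<in> X \<Longrightarrow> bck_le (\<star>) \<zero> x u"

locale bounded_commutative_bck_algebra = bounded_bck_algebra +
  assumes commutative: "x \<in> X \<Longrightarrow> y \<in> X \<Longrightarrow> x \<star> (x \<star> y) = y \<star> (y \<star> x)"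

definition bck_neg :: "('a \<Rightarrow> 'a \<Rightarrow> 'a) \<Rightarrow> 'a \<Rightarrow> 'a \<Rightarrow> 'a" where
  "bck_neg star u x = star u x"

definition bck_oplus :: "('a \<Rightarrow> 'a \<Rightarrow> 'a) \<Rightarrow> 'a \<Rightarrow> 'a \<Rightarrow> 'a \<Rightarrow> 'a" where
  "bck_oplus star u x y = bck_neg star u (star (bck_neg star u x) y)"

definition state_morphism_operator :: "'a set \<Rightarrow> ('a \<Rightarrow> 'a \<Rightarrow> 'a) \<Rightarrow> ('a \<Rightarrow> 'a) \<Rightarrow> bool" where
  "state_morphism_operator X star \<mu> \<longleftrightarrow>
     \<mu> \<in> X \<rightarrow> X \<and>
     (\<forall>x\<in>X. \<forall>y\<in>X. \<mu> (star x y) = star (\<mu> x) (\<mu> y)) \<and>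
     (\<forall>x\<in>X. \<mu> (\<mu> x) = \<mu> x)"

locale mv_algebra =
  fixes M :: "'a set"
    and oplus :: "'a \<Rightarrow> 'a \<Rightarrow> 'a"  (infixl \<open>\<oplus>\<close> 65)
    and neg :: "'a \<Rightarrow> 'a"
    and zero :: 'a  (\<open>\<zero>\<close>)
  assumes comm_monoid_oplus: "comm_monoid \<lparr>carrier = M, monoid.mult = (\<oplus>), one = \<zero>\<rparr>"
    and neg_closed: "x \<in> M \<Longrightarrow> neg x \<in> M"
    and neg_neg: "x \<in> M \<Longrightarrow> neg (neg x) = x"
    and oplus_one: "x \<in> M \<Longrightarrow> x \<oplus> neg \<zero> = neg \<zero>"
    and lukasiewicz: "x \<in> M \<Longrightarrow> y \<in> M \<Longrightarrow> x \<oplus> neg (x \<oplus> neg y) = y \<oplus> neg (y \<oplus> neg x)"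

locale mv_homomorphism =
  dom: mv_algebra M oplus neg zero + cod: mv_algebra M' oplus' neg' zero'
  for M :: "'a set" and oplus neg zero
    and M' :: "'b set" and oplus' neg' zero' +
  fixes h :: "'a \<Rightarrow> 'b"
  assumes hom_closed: "h \<in> M \<rightarrow> M'"
    and hom_oplus: "x \<in> M \<Longrightarrow> y \<in> M \<Longrightarrow> h (oplus x y) = oplus' (h x) (h y)"
    and hom_neg: "x \<in> M \<Longrightarrow> h (neg x) = neg' (h x)"
    and hom_zero: "h zero = zero'"

locale state_morphism_mv_algebra =
  mv_homomorphism M oplus neg zero M oplus neg zero \<sigma>
  for M :: "'a set" and oplus neg zero and \<sigma> :: "'a \<Rightarrow> 'a" +
  assumes idempotent: "x \<in> M \<Longrightarrow> \<sigma> (\<sigma> x) = \<sigma> x"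

end

theory Submission
  imports Defs
begin

text \<open>Write \<open>N x\<close> for \<open>u \<star> x\<close>. Two facts carry the proof. In every BCK-algebra the right
  arguments of iterated differences may be exchanged, \<open>(x \<star> y) \<star> z = (x \<star> z) \<star> y\<close>; and in a
  bounded commutative one \<open>N\<close> is an involution, since \<open>N (N x) = x \<star> (x \<star> u)\<close> and \<open>x \<star> u\<close>
  vanishes. Hence \<open>N (x \<oplus> y) = N x \<star> y\<close>, and exchange makes this expression, as well as
  \<open>N (x \<oplus> y \<oplus> z) = (N x \<star> y) \<star> z\<close>, independent of the order of the summands: this is
  commutativity and associativity of \<open>\<oplus>\<close>. The Lukasiewicz axiom holds because the negation of
  its left-hand side is \<open>N x \<star> (N x \<star> N y)\<close>, which is symmetric in \<open>x\<close> and \<open>y\<close> by the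
  commutativity law of the BCK-algebra.

  The MV-operations are terms in \<open>\<star>\<close> and \<open>u\<close>, and the zero is \<open>\<zero> \<star> \<zero>\<close>, so a map that
  preserves \<open>\<star>\<close> and \<open>u\<close> is an MV-homomorphism.\<close>

context bck_algebra
begin

lemma star_self: "x \<in> X \<Longrightarrow> x \<star> x = \<zero>"
  using bck1[of x \<zero> \<zero>] by (simp add: zero_closed bck2 bck4 star_closed)

lemma star_star_le: "x \<in> X \<Longrightarrow> y \<in> X \<Longrightarrow> (x \<star> (x \<star> y)) \<star> y = \<zero>"
  using bck1[of x \<zero> y] by (simp add: zero_closed bck2)

lemma le_trans:
  assumes "x \<in> X" "y \<in> X" "z \<in> X" "x \<star> y = \<zero>" "y \<star> z = \<zero>"
  shows "x \<star> z = \<zero>"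
  using bck1[of x z y] assms by (simp add: bck2 star_closed)

lemma star_antimono_right:
  assumes "x \<in> X" "y \<in> X" "z \<in> X" "x \<star> y = \<zero>"
  shows "(z \<star> y) \<star> (z \<star> x) = \<zero>"
  using bck1[of z y x] assms by (simp add: bck2 star_closed)

lemma star_exchange_le:
  assumes "x \<in> X" "y \<in> X" "z \<in> X"
  shows "((x \<star> y) \<star> z) \<star> ((x \<star> z) \<star> y) = \<zero>"
proof (rule le_trans)
  \<comment> \<open>Enlarge the first term by replacing \<open>z\<close> with the smaller \<open>x \<star> (x \<star> z)\<close>; the result is
    bounded by the first axiom.\<close>
  show "((x \<star> y) \<star> z) \<star> ((x \<star> y) \<star> (x \<star> (x \<star> z))) = \<zero>"
    using assms by (intro star_antimono_right star_star_le star_closed)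
  show "((x \<star> y) \<star> (x \<star> (x \<star> z))) \<star> ((x \<star> z) \<star> y) = \<zero>"
    using assms by (intro bck1 star_closed)
qed (use assms in \<open>auto intro!: star_closed\<close>)

lemma star_exchange:
  assumes "x \<in> X" "y \<in> X" "z \<in> X"
  shows "(x \<star> y) \<star> z = (x \<star> z) \<star> y"
  by (rule bck3) (use assms in \<open>auto intro!: star_exchange_le star_closed\<close>)

end

context bounded_commutative_bck_algebra
begin

lemma star_u: "x \<in> X \<Longrightarrow> x \<star> u = \<zero>"
  using u_greatest by (simp add: bck_le_def)

lemma u_star_u_star: "x \<in> X \<Longrightarrow> u \<star> (u \<star> x) = x"
  by (simp add: commutative[of u x] star_u u_closed bck2)

lemma u_star_exchange:
  assumes "x \<in> X" "y \<in> X"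
  shows "(u \<star> x) \<star> y = (u \<star> y) \<star> x"
  using assms u_closed by (intro star_exchange)

text \<open>A sum is of the form \<open>u \<star> w\<close>. The equation removes it from the right argument of
  \<open>\<star>\<close>, so that the inner sum in \<open>x \<oplus> (y \<oplus> z)\<close> becomes an iterated difference, to which
  exchange applies.\<close>

lemma star_contrapositive:
  assumes "x \<in> X" "y \<in> X"
  shows "(u \<star> x) \<star> (u \<star> y) = y \<star> x"
  using u_star_exchange[of x "u \<star> y"] assms by (simp add: u_star_u_star u_closed star_closed)

lemma associated_mv_algebra: "mv_algebra X (bck_oplus (\<star>) u) (bck_neg (\<star>) u) \<zero>"
proof
  fix x y z
  assume x: "x \<in> carrier \<lparr>carrier = X, monoid.mult = bck_oplus (\<star>) u, one = \<zero>\<rparr>"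
    and y: "y \<in> carrier \<lparr>carrier = X, monoid.mult = bck_oplus (\<star>) u, one = \<zero>\<rparr>"
    and z: "z \<in> carrier \<lparr>carrier = X, monoid.mult = bck_oplus (\<star>) u, one = \<zero>\<rparr>"
  have "((u \<star> x) \<star> y) \<star> z = ((u \<star> y) \<star> z) \<star> x"
    using x y z u_star_exchange[of x y] star_exchange[of "u \<star> y" x z]
    by (simp add: u_closed star_closed)
  also have "\<dots> = (u \<star> x) \<star> (u \<star> ((u \<star> y) \<star> z))"
    using x y z by (simp add: star_contrapositive u_closed star_closed)
  finally show "x \<otimes>\<^bsub>\<lparr>carrier = X, monoid.mult = bck_oplus (\<star>) u, one = \<zero>\<rparr>\<^esub> y
      \<otimes>\<^bsub>\<lparr>carrier = X, monoid.mult = bck_oplus (\<star>) u, one = \<zero>\<rparr>\<^esub> z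
    = x \<otimes>\<^bsub>\<lparr>carrier = X, monoid.mult = bck_oplus (\<star>) u, one = \<zero>\<rparr>\<^esub>
      (y \<otimes>\<^bsub>\<lparr>carrier = X, monoid.mult = bck_oplus (\<star>) u, one = \<zero>\<rparr>\<^esub> z)"
    using x y z by (simp add: bck_oplus_def bck_neg_def u_star_u_star u_closed star_closed)
next
  fix x y assume "x \<in> X" "y \<in> X"
  then show "bck_oplus (\<star>) u x (bck_neg (\<star>) u (bck_oplus (\<star>) u x (bck_neg (\<star>) u y)))
    = bck_oplus (\<star>) u y (bck_neg (\<star>) u (bck_oplus (\<star>) u y (bck_neg (\<star>) u x)))"
    using commutative[of "u \<star> x" "u \<star> y"]
    by (simp add: bck_oplus_def bck_neg_def u_star_u_star u_closed star_closed)
qed (auto simp: bck_oplus_def bck_neg_def u_star_exchange u_star_u_star star_u star_self bck2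
      u_closed zero_closed star_closed)

end

theorem theorem4p20:
  fixes X :: "'a set" and star :: "'a \<Rightarrow> 'a \<Rightarrow> 'a" and zero u :: 'a and \<mu> :: "'a \<Rightarrow> 'a"
  assumes "bounded_commutative_bck_algebra X star zero u"
    and "state_morphism_operator X star \<mu>"
    and "\<mu> u = u"
  shows "state_morphism_mv_algebra X (bck_oplus star u) (bck_neg star u) zero \<mu>"
proof -
  interpret bounded_commutative_bck_algebra X star zero u by fact
  interpret mv: mv_algebra X "bck_oplus star u" "bck_neg star u" zero
    by (rule associated_mv_algebra)
  have closed: "\<mu> \<in> X \<rightarrow> X"
    and hom: "\<And>x y. x \<in> X \<Longrightarrow> y \<in> X \<Longrightarrow> \<mu> (star x y) = star (\<mu> x) (\<mu> y)"
    and idem: "\<And>x. x \<in> X \<Longrightarrow> \<mu> (\<mu> x) = \<mu> x"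
    using assms(2) by (auto simp: state_morphism_operator_def)
  have "\<mu> zero = star (\<mu> zero) (\<mu> zero)"
    using hom[of zero zero] by (simp add: star_self zero_closed)
  then have "\<mu> zero = zero"
    using closed zero_closed star_self by (metis PiE)
  then show ?thesis
    by unfold_locales
      (use closed idem in \<open>simp_all add: bck_oplus_def bck_neg_def hom assms(3) u_closed star_closed\<close>)
qed

end
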